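(* Let $V$ be a finite dimensional $\mathbb R$-vector space, $S\subset V$ a discrete semigroup and $f:S\to\mathbb R$ a subadditive function, i.e. $f(u+v)\le f(u)+f(v)$ for all $u,v\in S$. Then: (i) For all $x\in\mathring{C}(S)$ and all sequences $\varepsilon_ku_k$ with $\varepsilon_k>0$, $u_k\in S$, $\varepsilon_k\to0$ and $\varepsilon_ku_k\to x$, the limit $$\hat f(x)=\lim_{k\to\infty}\varepsilon_kf(u_k)$$ exists in $\mathbb R\cup\{-\infty\}$ and only depends on $x$. (ii) Either $\hat f\equiv-\infty$ on $\mathring{C}(S)$, or $\hat f:\mathring{C}(S)\to\mathbb R$ is finite valued, homogeneous and subadditive (and hence convex and continuous). In the latter case $\hat f\le f$ on $S\cap\mathring{C}(S)$, and $\hat f$ is characterized as the largest subadditive and homogeneous function on $\mathring{C}(S)$ with this property.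
   Context: A subsemigroup $S\subset V$ is a non-empty subset stable under sums. $\mathbb ZS=\{s-s':s,s'\in S\}$ is the subgroup spanned by $S$, and $S$ is called a discrete semigroup if $\mathbb ZS$ is discrete in $V$. $\mathbb RS\subset V$ is the $\mathbb R$-vector space spanned by $S$, $C(S)\subset\mathbb RS$ is the convex cone spanned by $S$, and $\mathring{C}(S)$ is its relative interior, i.e. its interior in $\mathbb RS$. "Homogeneous" means $g(tx)=t\,g(x)$ for $t>0$. *)

theory Defs
  imports "HOL-Analysis.Analysis"
begin

definition subsemigroup :: "'a::real_vector set \<Rightarrow> bool"
  where "subsemigroup S \<longleftrightarrow> S \<noteq> {} \<and> (\<forall>u\<in>S. \<forall>v\<in>S. u + v \<in> S)"

definition diff_group :: "'a::real_vector set \<Rightarrow> 'a set"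
  where "diff_group S = {s - s' | s s'. s \<in> S \<and> s' \<in> S}"

definition discrete_semigroup :: "'a::real_normed_vector set \<Rightarrow> bool"
  where "discrete_semigroup S \<longleftrightarrow> subsemigroup S \<and> discrete (diff_group S)"

definition subadditive_on :: "'a::real_vector set \<Rightarrow> ('a \<Rightarrow> real) \<Rightarrow> bool"
  where "subadditive_on A g \<longleftrightarrow> (\<forall>u\<in>A. \<forall>v\<in>A. g (u + v) \<le> g u + g v)"

definition homogeneous_on :: "'a::real_vector set \<Rightarrow> ('a \<Rightarrow> real) \<Rightarrow> bool"
  where "homogeneous_on A g \<longleftrightarrow> (\<forall>x\<in>A. \<forall>t>0. g (t *\<^sub>R x) = t * g x)"

text \<open>
  The relative interior of the convex cone spanned by \<open>S\<close>. The library's convex cones contain \<open>0\<close>,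
  which does not affect the relative interior; the library takes the latter with respect
  to the affine hull, which for the cone is the linear span of \<open>S\<close> (see the lemma below).
\<close>
definition open_cone :: "'a::euclidean_space set \<Rightarrow> 'a set"
  where "open_cone S = rel_interior (convex_cone hull S)"

lemma open_cone_eq_interior_in_span:
  "open_cone S = top_of_set (span S) interior_of (convex_cone hull S)"
proof -
  have "convex_cone (span S)"
    by (simp add: convex_cone_iff span_add span_scale span_zero)
  then have sub: "convex_cone hull S \<subseteq> span S"
    by (intro hull_minimal span_superset)
  have "S \<subseteq> convex_cone hull S"
    by (rule hull_subset)
  then have "span (convex_cone hull S) = span S"
    using sub by (meson span_minimal span_mono subset_antisym subspace_span)
  moreover have "affine hull (convex_cone hull S) = span (convex_cone hull S)"
    by (intro affine_hull_span_0 hull_inc convex_cone_hull_contains_0)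
  ultimately show ?thesis
    by (auto simp: open_cone_def rel_interior_def interior_of_def)
qed

definition approx_seq ::
  "'a::real_normed_vector set \<Rightarrow> 'a \<Rightarrow> (nat \<Rightarrow> real) \<Rightarrow> (nat \<Rightarrow> 'a) \<Rightarrow> bool"
  where "approx_seq S x \<epsilon> u \<longleftrightarrow>
    (\<forall>k. 0 < \<epsilon> k) \<and> (\<forall>k. u k \<in> S) \<and> \<epsilon> \<longlonglongrightarrow> 0 \<and> (\<lambda>k. \<epsilon> k *\<^sub>R u k) \<longlonglongrightarrow> x"

text \<open>
  The common limit of the sequences \<open>\<epsilon> k * f (u k)\<close>, taken in the extended reals. It is meaningful
  only if \<open>x\<close> has an approximating sequence and the limit exists and is the same for all of them.
\<close>
definition asymptotic :: "'a::real_normed_vector set \<Rightarrow> ('a \<Rightarrow> real) \<Rightarrow> 'a \<Rightarrow> ereal"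
  where "asymptotic S f x =
    (THE l. \<forall>\<epsilon> u. approx_seq S x \<epsilon> u \<longrightarrow> (\<lambda>k. ereal (\<epsilon> k * f (u k))) \<longlonglongrightarrow> l)"

end

theory Submission
  imports Defs
begin

text \<open>
  Near a ray in the open cone, \<open>S\<close> coincides with the lattice \<open>\<int>S\<close> and \<open>f\<close> grows at most linearly.
  Given two sequences \<open>\<epsilon> u\<close> and \<open>\<delta> v\<close> converging to \<open>x\<close>, divide \<open>u\<close> by \<open>v\<close> with a remainder:
  \<open>u = n v + w\<close> where \<open>\<epsilon> n\<close> is slightly below \<open>(1 - \<eta>) \<delta>\<close>. Then \<open>\<epsilon> w\<close> is close to \<open>\<eta> x\<close>, so \<open>w\<close> is
  in \<open>S\<close>, and subadditivity gives \<open>\<epsilon> f(u) \<le> (1 - \<eta>) \<delta> f(v) + O(\<eta>)\<close>. Hence the limit superior along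
  one sequence is at most the limit inferior along the other.
\<close>

text \<open>Composing with a linear projection onto \<open>L\<close> reduces to convex functions on an open set.\<close>
lemma convex_on_continuous_relative:
  fixes K :: "'a::euclidean_space set"
  assumes L: "subspace L" and K: "openin (top_of_set L) K" and g: "convex_on K g"
  shows "continuous_on K g"
proof -
  obtain P :: "'a \<Rightarrow> 'a" where P: "linear P" "range P \<subseteq> L" "\<And>v. v \<in> L \<Longrightarrow> P v = v"
    using real_vector.linear_exists_left_inverse_on[OF linear_id L] by auto
  have contP: "continuous_on A P" for A
    using P(1) by (simp add: linear_continuous_on linear_conv_bounded_linear)
  obtain T where T: "open T" "K = L \<inter> T"
    using K by (auto simp: openin_open)
  have "P -` K = P -` T"
    using T P(2) by auto
  then have "open (P -` K)"
    using open_vimage[OF T(1) contP[of UNIV]] by simp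
  moreover have "convex_on (P -` K) (g \<circ> P)"
    using g P(1) by (auto simp: convex_on_def linear_add linear_scale convex_linear_vimage)
  ultimately have "continuous_on (P -` K) (g \<circ> P)"
    by (rule convex_on_continuous)
  moreover have KL: "K \<subseteq> L"
    using T by auto
  ultimately have "continuous_on K (g \<circ> P)"
    using P(3) by (elim continuous_on_subset) auto
  then show ?thesis
    using KL P(3) by (subst continuous_on_cong[OF refl, of _ _ "g \<circ> P"]) auto
qed

section \<open>Topology and convex geometry of the open cone\<close>

lemma openin_open_cone: "openin (top_of_set (span S)) (open_cone S)"
  by (simp add: open_cone_eq_interior_in_span)

lemma open_cone_subset_span: "open_cone S \<subseteq> span S"
  using openin_imp_subset[OF openin_open_cone] .

lemma open_cone_ball:
  assumes "x \<in> open_cone S"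
  obtains r where "0 < r" "\<And>y. \<lbrakk>y \<in> span S; dist y x < r\<rbrakk> \<Longrightarrow> y \<in> open_cone S"
  using openin_open_cone[of S] assms unfolding openin_euclidean_subtopology_iff by blast

lemma convex_open_cone: "convex (open_cone S)"
  by (simp add: open_cone_def convex_rel_interior convex_convex_cone_hull)

lemma open_cone_scale:
  assumes x: "x \<in> open_cone S" and t: "0 < t"
  shows "t *\<^sub>R x \<in> open_cone S"
proof -
  let ?C = "convex_cone hull S"
  have "y \<in> (*\<^sub>R) t ` ?C" if "y \<in> ?C" for y
  proof
    show "y = t *\<^sub>R (inverse t *\<^sub>R y)"
      using t by simp
  qed (use t that in \<open>simp add: convex_cone_hull_mul\<close>)
  then have "(*\<^sub>R) t ` ?C = ?C"
    using t by (auto simp: convex_cone_hull_mul)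
  then show ?thesis
    using rel_interior_scaleR[of t ?C] x t by (auto simp: open_cone_def)
qed

lemma open_cone_add:
  assumes "x \<in> open_cone S" "y \<in> open_cone S"
  shows "x + y \<in> open_cone S"
proof -
  have "(1/2) *\<^sub>R x + (1/2) *\<^sub>R y \<in> open_cone S"
    using assms by (intro convexD[OF convex_open_cone]) auto
  from open_cone_scale[OF this, of 2] show ?thesis
    by (simp add: scaleR_add_right)
qed

text \<open>Relative openness leaves room to subtract a small multiple of any spanned vector. This
  supplies positive slack on a basis for the local generators, and the splitting
  \<open>y = (y - d x) + d x\<close> behind the dichotomy.\<close>

lemma open_cone_shift:
  assumes x: "x \<in> open_cone S" and y: "y \<in> span S"
  obtains d where "0 < d" "x - d *\<^sub>R y \<in> open_cone S"
proof -
  obtain r where r: "0 < r" "\<And>y. \<lbrakk>y \<in> span S; dist y x < r\<rbrakk> \<Longrightarrow> y \<in> open_cone S"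
    using open_cone_ball[OF x] by blast
  \<comment> \<open>The \<open>+ 1\<close> covers \<open>y = 0\<close> and makes
    \<open>d * norm y < r\<close> strict.\<close>
  define d where "d = r / (norm y + 1)"
  have "0 < d"
    using r by (simp add: d_def add_nonneg_pos)
  moreover have "d * norm y < r"
  proof -
    have "r * norm y < r * (norm y + 1)"
      using r by simp
    then show ?thesis
      by (simp add: d_def divide_less_eq add_nonneg_pos)
  qed
  then have "x - d *\<^sub>R y \<in> open_cone S"
    using x y open_cone_subset_span[of S] \<open>0 < d\<close>
    by (intro r span_diff span_scale) (auto simp: dist_norm)
  ultimately show ?thesis
    using that by blast
qed

lemma homogeneous_subadditive_imp_convex_on:
  assumes "homogeneous_on (open_cone S) g" "subadditive_on (open_cone S) g"
  shows "convex_on (open_cone S) g"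
proof
  fix t x y
  assume t: "0 < t" "t < (1::real)" and xy: "x \<in> open_cone S" "y \<in> open_cone S"
  have "g ((1 - t) *\<^sub>R x + t *\<^sub>R y) \<le> g ((1 - t) *\<^sub>R x) + g (t *\<^sub>R y)"
    using assms t xy by (simp add: subadditive_on_def open_cone_scale)
  then show "g ((1 - t) *\<^sub>R x + t *\<^sub>R y) \<le> (1 - t) * g x + t * g y"
    using assms t xy by (simp add: homogeneous_on_def)
qed (rule convex_open_cone)

lemma homogeneous_subadditive_imp_continuous_on:
  assumes "homogeneous_on (open_cone S) g" "subadditive_on (open_cone S) g"
  shows "continuous_on (open_cone S) g"
  using convex_on_continuous_relative[OF subspace_span openin_open_cone]
    homogeneous_subadditive_imp_convex_on[OF assms] .

section \<open>Nonnegative bounded coordinates near a point of the open cone\<close>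

lemma convex_cone_hull_finite_combination:
  assumes "z \<in> convex_cone hull S" "S \<noteq> {}"
  obtains T c where "finite T" "T \<subseteq> S" "\<And>t. t \<in> T \<Longrightarrow> 0 \<le> c t" "z = (\<Sum>t\<in>T. c t *\<^sub>R t)"
proof -
  obtain w a where w: "w \<in> convex hull S" "0 \<le> a" "z = a *\<^sub>R w"
    using assms by (auto simp: convex_cone_hull_convex_hull_nonempty)
  then obtain T c where "finite T" "T \<subseteq> S" "\<forall>t\<in>T. 0 \<le> c t" "(\<Sum>t\<in>T. c t *\<^sub>R t) = w"
    unfolding convex_hull_explicit by auto
  with w show ?thesis
    by (intro that[of T "\<lambda>t. a * c t"]) (auto simp: scaleR_sum_right)
qed

text \<open>Subtracting \<open>d\<close> times the sum of a basis \<open>B\<close> from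
  \<open>x\<close> stays in the cone, hence gives a nonnegative combination of a finite
  \<open>T\<close>. Adding it back leaves slack \<open>d\<close> on every basis vector, and this
  absorbs the change of coordinates from \<open>x\<close> to a nearby \<open>y\<close>. The same
  \<open>T\<close> and \<open>C\<close> serve the whole ball; \<open>C\<close> later bounds the
  number of copies of each generator.\<close>

lemma open_cone_local_generators:
  fixes S :: "'a::euclidean_space set"
  assumes x: "x \<in> open_cone S" and "S \<noteq> {}"
  obtains T r C where "finite T" "T \<subseteq> S" "0 < r"
    "\<forall>y\<in>span S. dist y x < r \<longrightarrow>
      (\<exists>a. (\<forall>t\<in>T. 0 \<le> a t \<and> a t \<le> (C::real)) \<and> y = (\<Sum>t\<in>T. a t *\<^sub>R t))"
proof -
  \<comment> \<open>The basis is chosen inside \<open>S\<close>, so that \<open>T \<union> B\<close>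
    consists of elements of \<open>S\<close>.\<close>
  obtain B where B: "B \<subseteq> S" "independent B" "S \<subseteq> span B"
    using maximal_independent_subset by blast
  have finB: "finite B"
    using B(2) by (rule independent_imp_finite)
  have span: "span B = span S"
    using B by (meson span_minimal span_mono subset_antisym subspace_span)
  \<comment> \<open>Coordinate functionals of \<open>B\<close>, extended to the whole space. Off
    \<open>span B\<close> the extension is arbitrary, so the expansion \<open>coord\<close> is
    claimed on the span only.\<close>
  have "\<forall>b. \<exists>g::'a \<Rightarrow> real. linear g \<and> (\<forall>v\<in>B. g v = of_bool (v = b))"
    by (intro allI linear_independent_extend[OF B(2)])
  then obtain \<phi> :: "'a \<Rightarrow> 'a \<Rightarrow> real"
    where lin: "\<And>b. linear (\<phi> b)" and \<phi>: "\<And>b v. v \<in> B \<Longrightarrow> \<phi> b v = of_bool (v = b)"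
    by metis
  have coord: "(\<Sum>b\<in>B. \<phi> b y *\<^sub>R b) = y" if "y \<in> span B" for y
    using that
  proof (induction rule: span_induct_alt)
    case base
    then show ?case by (simp add: linear_0[OF lin])
  next
    case (step c v y)
    have "(\<Sum>b\<in>B. of_bool (v = b) *\<^sub>R b) = (\<Sum>b\<in>B. if v = b then b else 0)"
      by (rule sum.cong) auto
    then have "(\<Sum>b\<in>B. \<phi> b v *\<^sub>R b) = v"
      using step finB by (simp add: \<phi>)
    with step show ?case
      by (simp add: linear_add[OF lin] linear_scale[OF lin] scaleR_add_left sum.distrib
          flip: scaleR_scaleR scaleR_sum_right)
  qed
  have "(\<Sum>b\<in>B. b) \<in> span S"
    using B by (meson span_base span_sum subsetD)
  then obtain d where d: "0 < d" "x - d *\<^sub>R (\<Sum>b\<in>B. b) \<in> open_cone S"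
    using open_cone_shift[OF x] by blast
  then have "x - d *\<^sub>R (\<Sum>b\<in>B. b) \<in> convex_cone hull S"
    using rel_interior_subset by (auto simp: open_cone_def)
  then obtain T c where T: "finite T" "T \<subseteq> S" "\<And>t. t \<in> T \<Longrightarrow> 0 \<le> c t"
      "x - d *\<^sub>R (\<Sum>b\<in>B. b) = (\<Sum>t\<in>T. c t *\<^sub>R t)"
    using convex_cone_hull_finite_combination \<open>S \<noteq> {}\<close> by blast
  have "\<forall>\<^sub>F y in nhds x. \<forall>b\<in>B. dist (\<phi> b y) (\<phi> b x) < d"
  proof (intro eventually_ball_finite finB ballI)
    fix b
    have "isCont (\<phi> b) x"
      using lin[of b] by (simp add: linear_continuous_at linear_conv_bounded_linear)
    then have "(\<phi> b \<longlongrightarrow> \<phi> b x) (nhds x)"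
      by (simp add: continuous_at tendsto_at_iff_tendsto_nhds)
    then show "\<forall>\<^sub>F y in nhds x. dist (\<phi> b y) (\<phi> b x) < d"
      using d(1) by (rule tendstoD)
  qed
  then obtain r where r: "0 < r" "\<And>y b. \<lbrakk>dist y x < r; b \<in> B\<rbrakk> \<Longrightarrow> dist (\<phi> b y) (\<phi> b x) < d"
    by (auto simp: eventually_nhds_metric)
  show ?thesis
  proof (rule that[of "T \<union> B" r "(\<Sum>t\<in>T. c t) + 2 * d"]; (intro ballI impI)?)
    fix y
    assume y: "y \<in> span S" "dist y x < r"
    \<comment> \<open>The slack \<open>d\<close> plus the coordinate of \<open>y - x\<close> at
      \<open>b\<close>; it lies between 0 and \<open>2 * d\<close> by the choice of
      \<open>r\<close>.\<close>
    define e where "e b = d + \<phi> b y - \<phi> b x" for b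
    \<comment> \<open>\<open>T\<close> and \<open>B\<close> may overlap, so on common vectors both
      coefficients are added.\<close>
    define a where "a t = (if t \<in> T then c t else 0) + (if t \<in> B then e t else 0)" for t
    have e: "0 \<le> e b \<and> e b \<le> 2 * d" if "b \<in> B" for b
      using r(2)[OF y(2) that] by (auto simp: e_def dist_real_def)
    have "(\<Sum>b\<in>B. e b *\<^sub>R b) = d *\<^sub>R (\<Sum>b\<in>B. b) + (y - x)"
      using y coord[of x] coord[of y] x open_cone_subset_span[of S]
      by (auto simp: e_def span scaleR_add_left scaleR_diff_left sum.distrib sum_subtractf
          scaleR_sum_right)
    moreover have "(\<Sum>t\<in>T \<union> B. (if t \<in> A then p t else 0) *\<^sub>R t) = (\<Sum>t\<in>A. p t *\<^sub>R t)"
      if "A \<subseteq> T \<union> B" for A and p :: "'a \<Rightarrow> real"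
      using T(1) finB that by (intro sum.mono_neutral_cong_right) auto
    from this[of T c] this[of B e]
    have "(\<Sum>t\<in>T \<union> B. a t *\<^sub>R t) = (\<Sum>t\<in>T. c t *\<^sub>R t) + (\<Sum>b\<in>B. e b *\<^sub>R b)"
      by (simp add: a_def scaleR_add_left sum.distrib)
    ultimately have "y = (\<Sum>t\<in>T \<union> B. a t *\<^sub>R t)"
      using T(4) by (simp add: algebra_simps)
    moreover have "0 \<le> a t \<and> a t \<le> (\<Sum>t\<in>T. c t) + 2 * d" for t
    proof -
      have "0 \<le> (if t \<in> T then c t else 0) \<and> (if t \<in> T then c t else 0) \<le> (\<Sum>t\<in>T. c t)"
        using T by (auto intro: member_le_sum sum_nonneg)
      moreover have "0 \<le> (if t \<in> B then e t else 0) \<and> (if t \<in> B then e t else 0) \<le> 2 * d"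
        using e d by auto
      ultimately show ?thesis
        by (auto simp: a_def)
    qed
    ultimately show "\<exists>a. (\<forall>t\<in>T \<union> B. 0 \<le> a t \<and> a t \<le> (\<Sum>t\<in>T. c t) + 2 * d) \<and>
        y = (\<Sum>t\<in>T \<union> B. a t *\<^sub>R t)"
      by (intro exI[of _ a]) simp
  qed (use T(1,2) B(1) finB r(1) in auto)
qed

section \<open>The group of differences as a lattice\<close>

lemma subsemigroup_subset_diff_group:
  assumes "subsemigroup S"
  shows "S \<subseteq> diff_group S"
proof
  fix s assume "s \<in> S"
  then have "s + s \<in> S" "s = (s + s) - s"
    using assms by (auto simp: subsemigroup_def)
  then show "s \<in> diff_group S"
    using \<open>s \<in> S\<close> unfolding diff_group_def by blast
qed

lemma diff_group_diff:
  assumes S: "subsemigroup S" and "x \<in> diff_group S" "y \<in> diff_group S"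
  shows "x - y \<in> diff_group S"
proof -
  obtain a b c d where *: "a \<in> S" "b \<in> S" "c \<in> S" "d \<in> S" "x = a - b" "y = c - d"
    using assms by (auto simp: diff_group_def)
  then have "x - y = (a + d) - (b + c)" "a + d \<in> S" "b + c \<in> S"
    using S by (auto simp: subsemigroup_def)
  then show ?thesis
    unfolding diff_group_def by blast
qed

lemma diff_group_subset_span: "diff_group S \<subseteq> span S"
  by (auto simp: diff_group_def intro: span_diff span_base)

text \<open>In a group, isolation of 0 transfers by translation to a uniform distance between
  distinct points, and a bounded uniformly discrete set in Euclidean space is finite.\<close>

lemma finite_diff_group_Int_bounded:
  fixes S :: "'a::euclidean_space set"
  assumes S: "discrete_semigroup S" and X: "bounded X"
  shows "finite (diff_group S \<inter> X)"
proof -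
  let ?G = "diff_group S"
  have sub: "subsemigroup S" and disc: "discrete ?G"
    using S by (auto simp: discrete_semigroup_def)
  obtain s where s: "s \<in> S"
    using sub by (auto simp: subsemigroup_def)
  have "0 \<in> ?G"
    using diff_group_diff[OF sub, of s s] s subsemigroup_subset_diff_group[OF sub] by auto
  then obtain d where d: "0 < d" "\<And>y. \<lbrakk>y \<in> ?G; dist 0 y < d\<rbrakk> \<Longrightarrow> y = 0"
    using discreteD[OF disc] isolated_inE_dist by metis
  have "x = y" if "x \<in> ?G" "y \<in> ?G" "dist x y < d" for x y
    using d(2)[of "x - y"] diff_group_diff[OF sub that(1,2)] that(3)
    by (simp add: dist_norm norm_minus_commute)
  then have "uniform_discrete ?G"
    using d(1) by (auto simp: uniform_discrete_def)
  then show ?thesis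
    using uniform_discrete_finite_iff[of "?G \<inter> X"] uniform_discrete_subset[of ?G "?G \<inter> X"]
      bounded_subset[OF X] by auto
qed

section \<open>Combinations of semigroup elements and the local linear bound\<close>

context
  fixes S :: "'a::euclidean_space set" and f :: "'a \<Rightarrow> real"
  assumes discrete: "discrete_semigroup S" and subadd: "subadditive_on S f"
begin

lemma semigroup: "subsemigroup S"
  using discrete by (simp add: discrete_semigroup_def)

lemma add_mem: "\<lbrakk>u \<in> S; v \<in> S\<rbrakk> \<Longrightarrow> u + v \<in> S"
  using semigroup by (simp add: subsemigroup_def)

lemma nonempty: "S \<noteq> {}"
  using semigroup by (simp add: subsemigroup_def)

lemma mem_diff_group: "u \<in> S \<Longrightarrow> u \<in> diff_group S"
  using subsemigroup_subset_diff_group[OF semigroup] by blast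

lemma subadd_add: "\<lbrakk>u \<in> S; v \<in> S\<rbrakk> \<Longrightarrow> f (u + v) \<le> f u + f v"
  using subadd by (simp add: subadditive_on_def)

text \<open>The summand \<open>s\<close> is there because \<open>S\<close> need not contain 0: the
  sum stays in \<open>S\<close> even for \<open>n = 0\<close>. The same applies to finite
  combinations below.\<close>

lemma subadd_multiple:
  assumes "s \<in> S" "t \<in> S"
  shows "s + real n *\<^sub>R t \<in> S" "f (s + real n *\<^sub>R t) \<le> f s + real n * f t"
proof (induction n)
  case (Suc n)
  have eq: "s + real (Suc n) *\<^sub>R t = (s + real n *\<^sub>R t) + t"
    by (simp add: algebra_simps)
  { case 1 show ?case
      using Suc add_mem assms unfolding eq by blast }
  { case 2 show ?case
      using Suc subadd_add[of "s + real n *\<^sub>R t" t] assms unfolding eq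
      by (simp add: algebra_simps) }
qed (use assms in auto)

lemma subadd_combination:
  assumes "s \<in> S" "finite T" "T \<subseteq> S"
  shows "s + (\<Sum>t\<in>T. real (n t) *\<^sub>R t) \<in> S \<and>
    f (s + (\<Sum>t\<in>T. real (n t) *\<^sub>R t)) \<le> f s + (\<Sum>t\<in>T. real (n t) * f t)"
  using assms(2,3)
proof (induction T)
  case (insert t T)
  let ?w = "s + (\<Sum>t\<in>T. real (n t) *\<^sub>R t)"
  have sums: "s + (\<Sum>t\<in>insert t T. real (n t) *\<^sub>R t) = ?w + real (n t) *\<^sub>R t"
    "(\<Sum>t\<in>insert t T. real (n t) * f t) = (\<Sum>t\<in>T. real (n t) * f t) + real (n t) * f t"
    using insert.hyps by (simp_all add: algebra_simps)
  have "?w \<in> S" "t \<in> S" "f ?w \<le> f s + (\<Sum>t\<in>T. real (n t) * f t)"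
    using insert by auto
  then show ?case
    unfolding sums using subadd_multiple[of ?w t "n t"] by auto
qed (use assms in simp)

text \<open>If \<open>\<rho> = p - q\<close>, then enlarging \<open>Q\<close> by \<open>q\<close>
  moves \<open>\<rho>\<close> to \<open>Q + p\<close>, and the translates already in
  \<open>S\<close> remain there. Finitely many such enlargements suffice.\<close>

lemma translate_into_semigroup:
  assumes "finite R" "R \<subseteq> diff_group S"
  shows "\<exists>Q\<in>S. \<forall>\<rho>\<in>R. Q + \<rho> \<in> S"
  using assms
proof (induction R)
  case empty
  then show ?case using nonempty by blast
next
  case (insert \<rho> R)
  then obtain Q p q where *: "Q \<in> S" "\<forall>\<rho>\<in>R. Q + \<rho> \<in> S" "p \<in> S" "q \<in> S" "\<rho> = p - q"
    by (auto simp: diff_group_def)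
  then have "Q + q + \<rho> \<in> S"
    using add_mem[of Q p] by (simp add: algebra_simps)
  moreover have "Q + q + \<sigma> \<in> S" if "\<sigma> \<in> R" for \<sigma>
    using * that add_mem[of "Q + \<sigma>" q] by (simp add: add.assoc add.commute[of q])
  ultimately show ?case
    using * by (intro bexI[of _ "Q + q"]) (auto simp: add_mem)
qed

text \<open>
  Near the ray through \<open>x\<close>, every lattice vector \<open>u\<close> is \<open>Q + \<rho>\<close> plus a combination of finitely many
  generators with natural coefficients of size at most \<open>C / \<epsilon>\<close>. Here \<open>\<rho>\<close> is one of the finitely many
  lattice vectors arising as rounding errors, and the fixed \<open>Q\<close> is chosen such that all \<open>Q + \<rho>\<close> lie
  in \<open>S\<close>.
\<close>
lemma lattice_local_bound:
  assumes x: "x \<in> open_cone S"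
  obtains r \<epsilon>0 C where "0 < r" "0 < \<epsilon>0" "0 \<le> C"
    "\<forall>u\<in>diff_group S. \<forall>\<epsilon>. 0 < \<epsilon> \<and> \<epsilon> < \<epsilon>0 \<and> dist (\<epsilon> *\<^sub>R u) x < r \<longrightarrow> u \<in> S \<and> \<epsilon> * f u \<le> C"
proof -
  obtain T r C where T: "finite T" "T \<subseteq> S" and r: "0 < r"
    and gen: "\<forall>y\<in>span S. dist y x < r \<longrightarrow>
      (\<exists>a. (\<forall>t\<in>T. 0 \<le> a t \<and> a t \<le> (C::real)) \<and> y = (\<Sum>t\<in>T. a t *\<^sub>R t))"
    by (rule open_cone_local_generators[OF x nonempty])
  \<comment> \<open>All possible rounding errors: coefficients rounded to integers change by at most
    1, which bounds the norm of the error.\<close>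
  define R where "R = diff_group S \<inter> cball 0 (\<Sum>t\<in>T. norm t)"
  have "finite R"
    unfolding R_def by (rule finite_diff_group_Int_bounded[OF discrete]) simp
  moreover have "R \<subseteq> diff_group S"
    by (auto simp: R_def)
  ultimately obtain Q where Q: "Q \<in> S" "\<And>\<rho>. \<rho> \<in> R \<Longrightarrow> Q + \<rho> \<in> S"
    using translate_into_semigroup[of R] by auto
  define M where "M = (\<Sum>\<rho>\<in>R. \<bar>f (Q + \<rho>)\<bar>)"
  \<comment> \<open>The second bound gives \<open>norm (\<epsilon> *\<^sub>R Q) < r / 2\<close>, so
    replacing \<open>u\<close> by \<open>u - Q\<close> stays within \<open>r\<close> of
    \<open>x\<close>; the bound 1 gives \<open>\<epsilon> * M \<le> M\<close>.\<close>
  define \<epsilon>0 where "\<epsilon>0 = min 1 (r / (2 * (norm Q + 1)))"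
  have \<epsilon>0: "0 < \<epsilon>0"
    using r by (simp add: \<epsilon>0_def add_nonneg_pos)
  have M: "0 \<le> M" "\<And>\<rho>. \<rho> \<in> R \<Longrightarrow> f (Q + \<rho>) \<le> M"
  proof -
    fix \<rho> assume "\<rho> \<in> R"
    then have "\<bar>f (Q + \<rho>)\<bar> \<le> M"
      unfolding M_def using \<open>finite R\<close> by (intro member_le_sum) auto
    then show "f (Q + \<rho>) \<le> M" by simp
  qed (simp add: M_def sum_nonneg)
  show ?thesis
  proof (rule that[of "r / 2" \<epsilon>0 "M + \<bar>C\<bar> * (\<Sum>t\<in>T. \<bar>f t\<bar>)"]; (intro ballI allI impI)?)
    fix u \<epsilon>
    assume u: "u \<in> diff_group S" and "0 < \<epsilon> \<and> \<epsilon> < \<epsilon>0 \<and> dist (\<epsilon> *\<^sub>R u) x < r / 2"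
    then have \<epsilon>: "0 < \<epsilon>" "\<epsilon> < \<epsilon>0" and near: "dist (\<epsilon> *\<^sub>R u) x < r / 2"
      by auto
    have "\<epsilon> * norm Q \<le> \<epsilon> * (norm Q + 1)"
      using \<epsilon> by (intro mult_left_mono) auto
    also have "\<dots> < r / (2 * (norm Q + 1)) * (norm Q + 1)"
      using \<epsilon> by (intro mult_strict_right_mono) (auto simp: \<epsilon>0_def add_nonneg_pos)
    also have "\<dots> = r / 2"
    proof -
      have "norm Q + 1 \<noteq> 0"
        by (smt (verit) norm_ge_zero)
      then show ?thesis by (simp add: field_simps)
    qed
    finally have "norm (\<epsilon> *\<^sub>R Q) < r / 2"
      using \<epsilon> by simp
    moreover have "dist (\<epsilon> *\<^sub>R (u - Q)) x \<le> dist (\<epsilon> *\<^sub>R u) x + norm (\<epsilon> *\<^sub>R Q)"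
      using norm_triangle_ineq4[of "\<epsilon> *\<^sub>R u - x" "\<epsilon> *\<^sub>R Q"] by (simp add: dist_norm algebra_simps)
    ultimately have "dist (\<epsilon> *\<^sub>R (u - Q)) x < r"
      using near by simp
    moreover have "\<epsilon> *\<^sub>R (u - Q) \<in> span S"
      using u Q(1) diff_group_subset_span by (intro span_scale span_diff) (auto intro: span_base)
    ultimately have "\<exists>a. (\<forall>t\<in>T. 0 \<le> a t \<and> a t \<le> C) \<and> \<epsilon> *\<^sub>R (u - Q) = (\<Sum>t\<in>T. a t *\<^sub>R t)"
      using gen by simp
    then obtain a where a: "\<forall>t\<in>T. 0 \<le> a t \<and> a t \<le> C" "\<epsilon> *\<^sub>R (u - Q) = (\<Sum>t\<in>T. a t *\<^sub>R t)"
      by (elim exE conjE)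
    define n where "n t = nat \<lfloor>a t / \<epsilon>\<rfloor>" for t
    have n: "real (n t) \<le> a t / \<epsilon>" "\<bar>a t / \<epsilon> - real (n t)\<bar> \<le> 1" if "t \<in> T" for t
      using a(1) \<epsilon>(1) that unfolding n_def by (auto simp: of_nat_floor) linarith+
    define \<rho> where "\<rho> = (\<Sum>t\<in>T. (a t / \<epsilon> - real (n t)) *\<^sub>R t)"
    have "u - Q = (1 / \<epsilon>) *\<^sub>R (\<epsilon> *\<^sub>R (u - Q))"
      using \<epsilon>(1) by simp
    also have "\<dots> = (\<Sum>t\<in>T. (a t / \<epsilon>) *\<^sub>R t)"
      unfolding a(2) by (simp add: scaleR_sum_right)
    finally have u_eq: "u = (Q + \<rho>) + (\<Sum>t\<in>T. real (n t) *\<^sub>R t)"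
      by (simp add: \<rho>_def scaleR_diff_left sum_subtractf algebra_simps)
    \<comment> \<open>\<open>\<rho>\<close> is defined by real coefficients. It is nevertheless a
      lattice vector, being the difference of \<open>u\<close> and an element of
      \<open>S\<close>.\<close>
    have "Q + (\<Sum>t\<in>T. real (n t) *\<^sub>R t) \<in> S"
      using subadd_combination[OF Q(1) T] by blast
    then have "u - (Q + (\<Sum>t\<in>T. real (n t) *\<^sub>R t)) \<in> diff_group S"
      using diff_group_diff[OF semigroup u] mem_diff_group by blast
    then have "\<rho> \<in> diff_group S"
      by (simp add: u_eq)
    moreover have "norm \<rho> \<le> (\<Sum>t\<in>T. norm t)"
      unfolding \<rho>_def using n(2) by (intro sum_norm_le) (simp add: mult_left_le_one_le)
    ultimately have "\<rho> \<in> R"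
      by (simp add: R_def)
    from subadd_combination[OF Q(2)[OF this] T, of n]
    have uS: "u \<in> S" and fu: "f u \<le> f (Q + \<rho>) + (\<Sum>t\<in>T. real (n t) * f t)"
      by (simp_all flip: u_eq)
    note fu
    also have "\<dots> \<le> M + (\<Sum>t\<in>T. \<bar>C\<bar> / \<epsilon> * \<bar>f t\<bar>)"
    proof (intro add_mono M(2)[OF \<open>\<rho> \<in> R\<close>] sum_mono)
      fix t assume "t \<in> T"
      then have "real (n t) \<le> a t / \<epsilon>" "a t / \<epsilon> \<le> \<bar>C\<bar> / \<epsilon>"
        using n(1) a(1) \<epsilon>(1) by (auto intro!: divide_right_mono)
      then have "real (n t) \<le> \<bar>C\<bar> / \<epsilon>"
        by simp
      then have "real (n t) * \<bar>f t\<bar> \<le> \<bar>C\<bar> / \<epsilon> * \<bar>f t\<bar>"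
        by (intro mult_right_mono) auto
      moreover have "real (n t) * f t \<le> real (n t) * \<bar>f t\<bar>"
        by (intro mult_left_mono) auto
      ultimately show "real (n t) * f t \<le> \<bar>C\<bar> / \<epsilon> * \<bar>f t\<bar>"
        by simp
    qed
    finally have "\<epsilon> * f u \<le> \<epsilon> * (M + (\<Sum>t\<in>T. \<bar>C\<bar> / \<epsilon> * \<bar>f t\<bar>))"
      using \<epsilon>(1) by simp
    also have "\<dots> = \<epsilon> * M + \<bar>C\<bar> * (\<Sum>t\<in>T. \<bar>f t\<bar>)"
      using \<epsilon>(1) by (simp add: distrib_left flip: sum_distrib_left sum_divide_distrib)
    also have "\<epsilon> * M \<le> M"
      using M(1) \<epsilon> by (simp add: \<epsilon>0_def mult_left_le_one_le)
    finally show "u \<in> S \<and> \<epsilon> * f u \<le> M + \<bar>C\<bar> * (\<Sum>t\<in>T. \<bar>f t\<bar>)"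
      using uS by simp
  qed (use r \<epsilon>0 M(1) in \<open>simp_all add: sum_nonneg\<close>)
qed

section \<open>Comparing two approximating sequences\<close>

text \<open>The remainder \<open>w\<close> satisfies \<open>\<epsilon> w\<close> close to
  \<open>\<eta> x\<close>, so at scale \<open>\<epsilon> / \<eta>\<close> it is close to
  \<open>x\<close> and the local bound applies. Undoing the scaling multiplies that bound by
  \<open>\<eta>\<close>, so the remainder contributes at most \<open>\<eta> * C\<close>.\<close>

lemma approximate_euclidean_division:
  assumes local: "\<forall>w\<in>diff_group S. \<forall>\<epsilon>. 0 < \<epsilon> \<and> \<epsilon> < \<epsilon>0 \<and> dist (\<epsilon> *\<^sub>R w) x < r \<longrightarrow> w \<in> S \<and> \<epsilon> * f w \<le> C"
    and u: "u \<in> S" and v: "v \<in> S" and \<delta>: "0 < \<delta>" and \<eta>: "0 < \<eta>" "\<eta> < 1"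
    and \<epsilon>: "0 < \<epsilon>" "\<epsilon> < \<eta> * \<epsilon>0"
    and near: "dist (\<epsilon> *\<^sub>R u) x + (1 - \<eta>) * dist (\<delta> *\<^sub>R v) x + \<epsilon> * norm v < \<eta> * r"
  shows "\<epsilon> * f u \<le> (1 - \<eta>) * (\<delta> * f v) + \<epsilon> * \<bar>f v\<bar> + \<eta> * C"
proof -
  define n where "n = nat \<lfloor>(1 - \<eta>) * \<delta> / \<epsilon>\<rfloor>"
  \<comment> \<open>The loss from rounding the quotient down, measured at scale
    \<open>\<epsilon>\<close>; it lies between 0 and \<open>\<epsilon>\<close>.\<close>
  define \<theta> where "\<theta> = (1 - \<eta>) * \<delta> - \<epsilon> * real n"
  have n: "real n \<le> (1 - \<eta>) * \<delta> / \<epsilon>" "(1 - \<eta>) * \<delta> / \<epsilon> \<le> real n + 1"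
    using \<eta> \<delta> \<epsilon>(1) unfolding n_def by (simp add: of_nat_floor, linarith)
  then have \<theta>: "0 \<le> \<theta>" "\<theta> \<le> \<epsilon>"
    using \<epsilon>(1) by (simp_all add: \<theta>_def field_simps)
  define w where "w = u - real n *\<^sub>R v"
  \<comment> \<open>Since \<open>n\<close> may be 0 and \<open>S\<close> need not contain 0,
    \<open>v\<close> is added to both terms to exhibit a difference of elements of
    \<open>S\<close>.\<close>
  have "w = (u + v) - (v + real n *\<^sub>R v)"
    by (simp add: w_def)
  then have w: "w \<in> diff_group S"
    using diff_group_diff[OF semigroup] mem_diff_group add_mem[OF u v] subadd_multiple(1)[OF v v]
    by metis
  have "\<epsilon> *\<^sub>R w - \<eta> *\<^sub>R x = (\<epsilon> *\<^sub>R u - x) + ((1 - \<eta>) *\<^sub>R (x - \<delta> *\<^sub>R v) + \<theta> *\<^sub>R v)"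
    by (simp add: w_def \<theta>_def algebra_simps)
  also have "norm \<dots> \<le> norm (\<epsilon> *\<^sub>R u - x) + (norm ((1 - \<eta>) *\<^sub>R (x - \<delta> *\<^sub>R v)) + norm (\<theta> *\<^sub>R v))"
    by (intro norm_triangle_mono norm_triangle_ineq order_refl)
  also have "\<dots> \<le> dist (\<epsilon> *\<^sub>R u) x + ((1 - \<eta>) * dist (\<delta> *\<^sub>R v) x + \<epsilon> * norm v)"
    using \<theta> \<eta> by (intro add_mono) (simp_all add: dist_norm norm_minus_commute mult_right_mono)
  finally have "norm (\<epsilon> *\<^sub>R w - \<eta> *\<^sub>R x) < \<eta> * r"
    using near by simp
  moreover have "\<epsilon> *\<^sub>R w - \<eta> *\<^sub>R x = \<eta> *\<^sub>R ((\<epsilon> / \<eta>) *\<^sub>R w - x)"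
    using \<eta> by (simp add: algebra_simps)
  ultimately have "dist ((\<epsilon> / \<eta>) *\<^sub>R w) x < r"
    using \<eta> by (simp add: dist_norm)
  then have "w \<in> S" and fw: "\<epsilon> / \<eta> * f w \<le> C"
    using spec[OF bspec[OF local w], of "\<epsilon> / \<eta>"] \<eta> \<epsilon> by (simp_all add: divide_less_eq mult.commute)
  have "f u \<le> f w + real n * f v"
    using subadd_multiple(2)[OF \<open>w \<in> S\<close> v, of n] by (simp add: w_def)
  then have "\<epsilon> * f u \<le> \<epsilon> * (f w + real n * f v)"
    using \<epsilon>(1) by simp
  also have "\<dots> = (1 - \<eta>) * (\<delta> * f v) + (- \<theta>) * f v + \<epsilon> * f w"
    by (simp add: \<theta>_def algebra_simps)
  also have "\<dots> \<le> (1 - \<eta>) * (\<delta> * f v) + \<epsilon> * \<bar>f v\<bar> + \<eta> * C"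
  proof (intro add_mono order_refl)
    have "(- \<theta>) * f v \<le> \<theta> * \<bar>f v\<bar>"
      using \<theta>(1) abs_ge_minus_self[of "\<theta> * f v"] by (simp add: abs_mult)
    also have "\<dots> \<le> \<epsilon> * \<bar>f v\<bar>"
      using \<theta> by (simp add: mult_right_mono)
    finally show "(- \<theta>) * f v \<le> \<epsilon> * \<bar>f v\<bar>" .
    show "\<epsilon> * f w \<le> \<eta> * C"
      using fw \<eta> by (simp add: field_simps)
  qed
  finally show ?thesis .
qed

text \<open>One good index \<open>m\<close> of the second sequence is frozen, and every late
  \<open>u k\<close> is divided by the same \<open>v m\<close>. Errors proportional to
  \<open>\<epsilon> k\<close> then vanish, because \<open>v m\<close> no longer varies.\<close>

lemma approx_seq_eventually_le:
  assumes x: "x \<in> open_cone S" and u: "approx_seq S x \<epsilon> u" and v: "approx_seq S x \<delta> v"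
    and freq: "\<exists>\<^sub>F k in sequentially. \<delta> k * f (v k) < z" and e: "0 < e"
  shows "\<forall>\<^sub>F k in sequentially. \<epsilon> k * f (u k) \<le> z + e"
proof -
  obtain r \<epsilon>0 C where r: "0 < r" and \<epsilon>0: "0 < \<epsilon>0" and C: "0 \<le> C"
    and local: "\<forall>w\<in>diff_group S. \<forall>\<epsilon>. 0 < \<epsilon> \<and> \<epsilon> < \<epsilon>0 \<and> dist (\<epsilon> *\<^sub>R w) x < r \<longrightarrow> w \<in> S \<and> \<epsilon> * f w \<le> C"
    by (rule lattice_local_bound[OF x])
  \<comment> \<open>The budget \<open>e\<close> pays for three losses:
    \<open>\<eta> * \<bar>z\<bar>\<close> from replacing \<open>(1 - \<eta>) * z\<close> by
    \<open>z\<close>, \<open>\<eta> * C\<close> from the remainder, and \<open>\<eta>\<close> for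
    the term \<open>\<epsilon> k * \<bar>f (v m)\<bar>\<close>.\<close>
  define \<eta> where "\<eta> = min (1/2) (e / (\<bar>z\<bar> + C + 1))"
  have D: "0 < \<bar>z\<bar> + C + 1"
    using C by simp
  have \<eta>: "0 < \<eta>" "\<eta> < 1"
    using e D by (simp_all add: \<eta>_def)
  have "\<eta> \<le> e / (\<bar>z\<bar> + C + 1)"
    by (simp add: \<eta>_def)
  then have \<eta>e: "\<eta> * \<bar>z\<bar> + \<eta> * C + \<eta> \<le> e"
    using D by (simp add: pos_le_divide_eq distrib_left)
  \<comment> \<open>The allowed distance \<open>\<eta> * r\<close> is shared equally by the two
    approximation errors and the rounding error.\<close>
  have "\<forall>\<^sub>F k in sequentially. dist (\<delta> k *\<^sub>R v k) x < \<eta> * r / 3"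
    using v \<eta> r by (intro tendstoD) (auto simp: approx_seq_def)
  with freq have "\<exists>\<^sub>F k in sequentially. \<delta> k * f (v k) < z \<and> dist (\<delta> k *\<^sub>R v k) x < \<eta> * r / 3"
    by (rule frequently_eventually_conj[THEN frequently_elim1]) auto
  then obtain m where m: "\<delta> m * f (v m) < z" "dist (\<delta> m *\<^sub>R v m) x < \<eta> * r / 3"
    by (auto dest: frequently_ex)
  have vm: "v m \<in> S" "0 < \<delta> m"
    using v by (auto simp: approx_seq_def)
  have u': "\<And>k. u k \<in> S" "\<And>k. 0 < \<epsilon> k" and lim: "\<epsilon> \<longlonglongrightarrow> 0" "(\<lambda>k. \<epsilon> k *\<^sub>R u k) \<longlonglongrightarrow> x"
    using u by (auto simp: approx_seq_def)
  have small: "\<forall>\<^sub>F k in sequentially. \<epsilon> k * c < b" if "0 < b" for b c :: real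
    using tendsto_mult_left_zero[OF lim(1), of c] that by (rule order_tendstoD)
  have "\<forall>\<^sub>F k in sequentially. dist (\<epsilon> k *\<^sub>R u k) x < \<eta> * r / 3"
    using lim(2) \<eta> r by (intro tendstoD) auto
  moreover have "\<forall>\<^sub>F k in sequentially. \<epsilon> k * 1 < \<eta> * \<epsilon>0"
    using \<eta> \<epsilon>0 by (intro small) auto
  moreover have "\<forall>\<^sub>F k in sequentially. \<epsilon> k * norm (v m) < \<eta> * r / 3"
    using \<eta> r by (intro small) auto
  moreover have "\<forall>\<^sub>F k in sequentially. \<epsilon> k * \<bar>f (v m)\<bar> < \<eta>"
    using \<eta> by (intro small) auto
  ultimately show ?thesis
  proof eventually_elim
    case (elim k)
    have "(1 - \<eta>) * dist (\<delta> m *\<^sub>R v m) x \<le> dist (\<delta> m *\<^sub>R v m) x"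
      using \<eta> by (intro mult_left_le_one_le) auto
    then have "\<epsilon> k * f (u k) \<le> (1 - \<eta>) * (\<delta> m * f (v m)) + \<epsilon> k * \<bar>f (v m)\<bar> + \<eta> * C"
      using elim m(2) by (intro approximate_euclidean_division[OF local u'(1) vm \<eta> u'(2)]) auto
    moreover have "(1 - \<eta>) * (\<delta> m * f (v m)) \<le> (1 - \<eta>) * z"
      using m(1) \<eta> by (intro mult_left_mono) auto
    moreover have "(1 - \<eta>) * z \<le> z + \<eta> * \<bar>z\<bar>"
      using \<eta> abs_ge_minus_self[of "\<eta> * z"] by (simp add: abs_mult algebra_simps)
    ultimately show ?case
      using elim(4) \<eta>e by argo
  qed
qed

lemma limsup_le_liminf_approx_seq:
  assumes x: "x \<in> open_cone S" and u: "approx_seq S x \<epsilon> u" and v: "approx_seq S x \<delta> v"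
  shows "limsup (\<lambda>k. ereal (\<epsilon> k * f (u k))) \<le> liminf (\<lambda>k. ereal (\<delta> k * f (v k)))"
\<comment> \<open>Testing against real upper bounds \<open>z\<close> of the lower limit also handles
  a lower limit equal to minus infinity.\<close>
proof (rule ereal_le_real, rule ereal_le_epsilon2)
  fix z e :: real
  assume z: "liminf (\<lambda>k. ereal (\<delta> k * f (v k))) \<le> ereal z" and e: "0 < e"
  have "\<exists>\<^sub>F k in sequentially. \<delta> k * f (v k) < z + e / 2"
  proof (rule ccontr)
    assume "\<not> ?thesis"
    then have "\<forall>\<^sub>F k in sequentially. ereal (z + e / 2) \<le> ereal (\<delta> k * f (v k))"
      by (simp add: not_frequently not_less)
    from Liminf_bounded[OF this] have "ereal (z + e / 2) \<le> ereal z"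
      using z by (rule order_trans)
    then show False using e by simp
  qed
  from approx_seq_eventually_le[OF x u v this, of "e / 2"] e
  have "\<forall>\<^sub>F k in sequentially. ereal (\<epsilon> k * f (u k)) \<le> ereal z + ereal e"
    by (simp add: add.assoc)
  then show "limsup (\<lambda>k. ereal (\<epsilon> k * f (u k))) \<le> ereal z + ereal e"
    by (rule Limsup_bounded)
qed

section \<open>Existence of approximating sequences and of the limit\<close>

text \<open>Write \<open>x\<close> as a nonnegative combination of generators and round the
  coefficients of \<open>(k + 1) x\<close> down. Dividing by \<open>k + 1\<close> recovers
  \<open>x\<close> in the limit, and the fixed summand \<open>s\<close> disappears.\<close>

lemma approx_seq_exists:
  assumes x: "x \<in> open_cone S"
  obtains u where "approx_seq S x (\<lambda>k. inverse (real (Suc k))) u"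
proof -
  obtain s where s: "s \<in> S"
    using nonempty by blast
  obtain T r C where T: "finite T" "T \<subseteq> S" and r: "0 < r"
    and gen: "\<forall>y\<in>span S. dist y x < r \<longrightarrow>
      (\<exists>a. (\<forall>t\<in>T. 0 \<le> a t \<and> a t \<le> (C::real)) \<and> y = (\<Sum>t\<in>T. a t *\<^sub>R t))"
    by (rule open_cone_local_generators[OF x nonempty])
  have "\<exists>a. (\<forall>t\<in>T. 0 \<le> a t \<and> a t \<le> C) \<and> x = (\<Sum>t\<in>T. a t *\<^sub>R t)"
    using gen r subsetD[OF open_cone_subset_span x] by simp
  then obtain a where a: "\<forall>t\<in>T. 0 \<le> a t \<and> a t \<le> C" "x = (\<Sum>t\<in>T. a t *\<^sub>R t)"
    by (elim exE conjE)
  define n where "n k t = nat \<lfloor>real (Suc k) * a t\<rfloor>" for k t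
  define u where "u k = s + (\<Sum>t\<in>T. real (n k t) *\<^sub>R t)" for k
  have "(\<lambda>k. inverse (real (Suc k)) * real (n k t)) \<longlonglongrightarrow> a t" if "t \<in> T" for t
  proof (rule tendsto_sandwich)
    have n: "real (n k t) \<le> real (Suc k) * a t" "real (Suc k) * a t - 1 \<le> real (n k t)" for k
      using a(1) that unfolding n_def by (simp add: of_nat_floor, linarith)
    show "\<forall>\<^sub>F k in sequentially. inverse (real (Suc k)) * real (n k t) \<le> a t"
      using n(1) by (simp add: field_simps)
    have "a t - inverse (real (Suc k)) = inverse (real (Suc k)) * (real (Suc k) * a t - 1)" for k
      by (simp add: right_diff_distrib del: of_nat_Suc)
    then show "\<forall>\<^sub>F k in sequentially.
        a t - inverse (real (Suc k)) \<le> inverse (real (Suc k)) * real (n k t)"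
      using n(2) by (simp add: mult_left_mono del: of_nat_Suc)
    show "(\<lambda>k. a t - inverse (real (Suc k))) \<longlonglongrightarrow> a t"
      using tendsto_diff[OF tendsto_const LIMSEQ_inverse_real_of_nat, of "a t"] by simp
  qed simp
  then have "(\<lambda>k. inverse (real (Suc k)) *\<^sub>R s +
      (\<Sum>t\<in>T. (inverse (real (Suc k)) * real (n k t)) *\<^sub>R t))
      \<longlonglongrightarrow> 0 *\<^sub>R s + (\<Sum>t\<in>T. a t *\<^sub>R t)"
    by (intro tendsto_intros LIMSEQ_inverse_real_of_nat)
  then have "(\<lambda>k. inverse (real (Suc k)) *\<^sub>R u k) \<longlonglongrightarrow> x"
    by (simp add: u_def a(2) scaleR_add_right scaleR_sum_right)
  moreover have "u k \<in> S" for k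
    unfolding u_def using subadd_combination[OF s T] by blast
  ultimately show ?thesis
    by (intro that[of u]) (simp add: approx_seq_def LIMSEQ_inverse_real_of_nat del: of_nat_Suc)
qed

text \<open>Comparing an arbitrary sequence with one reference sequence in both directions squeezes
  its lower and upper limits to \<open>l\<close>. The reference sequence also makes the description
  in \<open>asymptotic\<close> unique, and the local bound along it excludes plus infinity.\<close>

lemma asymptotic_limit:
  assumes x: "x \<in> open_cone S"
  shows "asymptotic S f x \<noteq> \<infinity>"
    and "approx_seq S x \<epsilon> u \<Longrightarrow> (\<lambda>k. ereal (\<epsilon> k * f (u k))) \<longlonglongrightarrow> asymptotic S f x"
proof -
  obtain u0 where u0: "approx_seq S x (\<lambda>k. inverse (real (Suc k))) u0"
    by (rule approx_seq_exists[OF x])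
  define l where "l = limsup (\<lambda>k. ereal (inverse (real (Suc k)) * f (u0 k)))"
  have lim: "(\<lambda>k. ereal (\<epsilon> k * f (u k))) \<longlonglongrightarrow> l" if u: "approx_seq S x \<epsilon> u" for \<epsilon> u
  proof -
    let ?X = "\<lambda>k. ereal (\<epsilon> k * f (u k))"
    have "l \<le> liminf ?X"
      unfolding l_def by (rule limsup_le_liminf_approx_seq[OF x u0 u])
    moreover have "liminf ?X \<le> limsup ?X"
      by (simp add: Liminf_le_Limsup)
    moreover have "limsup ?X \<le> l"
      using limsup_le_liminf_approx_seq[OF x u u0]
        Liminf_le_Limsup[of sequentially "\<lambda>k. ereal (inverse (real (Suc k)) * f (u0 k))"]
      by (simp add: l_def)
    ultimately show ?thesis
      by (intro Liminf_eq_Limsup) auto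
  qed
  have eq: "asymptotic S f x = l"
    unfolding asymptotic_def
  proof (rule the_equality)
    fix l'
    assume "\<forall>\<epsilon> u. approx_seq S x \<epsilon> u \<longrightarrow> (\<lambda>k. ereal (\<epsilon> k * f (u k))) \<longlonglongrightarrow> l'"
    then have "(\<lambda>k. ereal (inverse (real (Suc k)) * f (u0 k))) \<longlonglongrightarrow> l'"
      using u0 by blast
    then show "l' = l"
      using lim[OF u0] LIMSEQ_unique by blast
  qed (use lim in blast)
  then show "approx_seq S x \<epsilon> u \<Longrightarrow> (\<lambda>k. ereal (\<epsilon> k * f (u k))) \<longlonglongrightarrow> asymptotic S f x"
    using lim by simp
  obtain r \<epsilon>0 C where r: "0 < r" and \<epsilon>0: "0 < \<epsilon>0" and "0 \<le> C"
    and local: "\<forall>w\<in>diff_group S. \<forall>\<epsilon>. 0 < \<epsilon> \<and> \<epsilon> < \<epsilon>0 \<and> dist (\<epsilon> *\<^sub>R w) x < r \<longrightarrow> w \<in> S \<and> \<epsilon> * f w \<le> C"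
    by (rule lattice_local_bound[OF x])
  have "\<forall>\<^sub>F k in sequentially. dist (inverse (real (Suc k)) *\<^sub>R u0 k) x < r"
    using u0 r by (intro tendstoD) (auto simp: approx_seq_def)
  moreover have "\<forall>\<^sub>F k in sequentially. inverse (real (Suc k)) < \<epsilon>0"
    using LIMSEQ_inverse_real_of_nat \<epsilon>0 by (rule order_tendstoD)
  ultimately have "\<forall>\<^sub>F k in sequentially. ereal (inverse (real (Suc k)) * f (u0 k)) \<le> ereal C"
  proof eventually_elim
    case (elim k)
    have u0k: "u0 k \<in> diff_group S"
      using u0 mem_diff_group by (simp add: approx_seq_def)
    show ?case
      using spec[OF bspec[OF local u0k], of "inverse (real (Suc k))"] elim by simp
  qed
  then have "l \<le> ereal C"
    unfolding l_def by (rule Limsup_bounded)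
  then show "asymptotic S f x \<noteq> \<infinity>"
    using eq by auto
qed

section \<open>Homogeneity, subadditivity, maximality and the dichotomy\<close>

lemma asymptotic_scale:
  assumes x: "x \<in> open_cone S" and t: "0 < t"
  shows "asymptotic S f (t *\<^sub>R x) = ereal t * asymptotic S f x"
proof -
  obtain u where u: "approx_seq S x (\<lambda>k. inverse (real (Suc k))) u"
    by (rule approx_seq_exists[OF x])
  let ?\<epsilon> = "\<lambda>k. inverse (real (Suc k))"
  have "approx_seq S (t *\<^sub>R x) (\<lambda>k. t * ?\<epsilon> k) u"
    using u t tendsto_mult_right_zero[of ?\<epsilon> sequentially t]
      tendsto_scaleR[OF tendsto_const, of "\<lambda>k. ?\<epsilon> k *\<^sub>R u k" x sequentially t]
    by (simp add: approx_seq_def)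
  then have "(\<lambda>k. ereal (t * ?\<epsilon> k * f (u k))) \<longlonglongrightarrow> asymptotic S f (t *\<^sub>R x)"
    by (rule asymptotic_limit(2)[OF open_cone_scale[OF x t]])
  moreover have "(\<lambda>k. ereal t * ereal (?\<epsilon> k * f (u k))) \<longlonglongrightarrow> ereal t * asymptotic S f x"
    using asymptotic_limit(2)[OF x u] by (rule tendsto_cmult_ereal[rotated]) simp
  ultimately show ?thesis
    by (intro LIMSEQ_unique) (simp_all add: mult.assoc)
qed

lemma asymptotic_add:
  assumes x: "x \<in> open_cone S" and y: "y \<in> open_cone S"
  shows "asymptotic S f (x + y) \<le> asymptotic S f x + asymptotic S f y"
proof -
  let ?\<epsilon> = "\<lambda>k. inverse (real (Suc k))"
  obtain u where u: "approx_seq S x ?\<epsilon> u"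
    by (rule approx_seq_exists[OF x])
  obtain v where v: "approx_seq S y ?\<epsilon> v"
    by (rule approx_seq_exists[OF y])
  have "(\<lambda>k. ?\<epsilon> k *\<^sub>R u k + ?\<epsilon> k *\<^sub>R v k) \<longlonglongrightarrow> x + y"
    using u v by (intro tendsto_add) (auto simp: approx_seq_def)
  then have "approx_seq S (x + y) ?\<epsilon> (\<lambda>k. u k + v k)"
    using u v by (simp add: approx_seq_def add_mem scaleR_add_right)
  then have "(\<lambda>k. ereal (?\<epsilon> k * f (u k + v k))) \<longlonglongrightarrow> asymptotic S f (x + y)"
    by (rule asymptotic_limit(2)[OF open_cone_add[OF x y]])
  \<comment> \<open>Neither limit is plus infinity, so no indeterminate sum of opposite infinities
    arises.\<close>
  moreover have "(\<lambda>k. ereal (?\<epsilon> k * f (u k)) + ereal (?\<epsilon> k * f (v k))) \<longlonglongrightarrow>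
      asymptotic S f x + asymptotic S f y"
    using asymptotic_limit x y u v by (intro tendsto_add_ereal_general) auto
  moreover have "ereal (?\<epsilon> k * f (u k + v k)) \<le>
      ereal (?\<epsilon> k * f (u k)) + ereal (?\<epsilon> k * f (v k))" for k
    using u v subadd_add[of "u k" "v k"]
      mult_left_mono[of "f (u k + v k)" "f (u k) + f (v k)" "?\<epsilon> k"]
    by (simp add: approx_seq_def distrib_left)
  ultimately show ?thesis
    by (intro LIMSEQ_le) auto
qed

text \<open>The multiples \<open>(k + 1) u\<close> with weights \<open>1 / (k + 1)\<close>
  approximate \<open>u\<close> exactly, and along them subadditivity bounds every term by
  \<open>f u\<close>.\<close>

lemma asymptotic_le:
  assumes u: "u \<in> S" "u \<in> open_cone S"
  shows "asymptotic S f u \<le> ereal (f u)"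
proof -
  let ?\<epsilon> = "\<lambda>k. inverse (real (Suc k))" and ?u = "\<lambda>k. u + real k *\<^sub>R u"
  have mult: "?u k = real (Suc k) *\<^sub>R u" for k
    by (simp add: algebra_simps)
  have "approx_seq S u ?\<epsilon> ?u"
    using subadd_multiple(1)[OF u(1) u(1)] LIMSEQ_inverse_real_of_nat
    unfolding approx_seq_def by (simp add: mult del: of_nat_Suc)
  from asymptotic_limit(2)[OF u(2) this] show ?thesis
  proof (rule LIMSEQ_le_const2, intro exI allI impI)
    fix k
    have "f (?u k) \<le> real (Suc k) * f u"
      using subadd_multiple(2)[OF u(1) u(1), of k] by (simp add: algebra_simps)
    then have "?\<epsilon> k * f (?u k) \<le> f u"
      by (simp add: field_simps)
    then show "ereal (?\<epsilon> k * f (?u k)) \<le> ereal (f u)"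
      by simp
  qed
qed

text \<open>Along an approximating sequence, homogeneity turns \<open>g u \<le> f u\<close> into a
  bound for \<open>g\<close> at the points \<open>\<epsilon> u\<close>, which eventually lie in the
  open cone. Continuity of \<open>g\<close>, a consequence of its convexity, passes this to the
  limit.\<close>

lemma asymptotic_greatest:
  assumes g: "homogeneous_on (open_cone S) g" "subadditive_on (open_cone S) g"
    and le: "\<And>u. u \<in> S \<inter> open_cone S \<Longrightarrow> g u \<le> f u" and x: "x \<in> open_cone S"
  shows "ereal (g x) \<le> asymptotic S f x"
proof -
  let ?\<epsilon> = "\<lambda>k. inverse (real (Suc k))"
  obtain u where u: "approx_seq S x ?\<epsilon> u"
    by (rule approx_seq_exists[OF x])
  then have lim: "(\<lambda>k. ?\<epsilon> k *\<^sub>R u k) \<longlonglongrightarrow> x" and uS: "\<And>k. u k \<in> S"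
    by (auto simp: approx_seq_def)
  obtain r where r: "0 < r" "\<And>y. \<lbrakk>y \<in> span S; dist y x < r\<rbrakk> \<Longrightarrow> y \<in> open_cone S"
    using open_cone_ball[OF x] by blast
  have ev: "\<forall>\<^sub>F k in sequentially. ?\<epsilon> k *\<^sub>R u k \<in> open_cone S"
    using tendstoD[OF lim r(1)]
    by eventually_elim (use r(2) uS in \<open>blast intro: span_scale span_base\<close>)
  have "(\<lambda>k. g (?\<epsilon> k *\<^sub>R u k)) \<longlonglongrightarrow> g x"
    using homogeneous_subadditive_imp_continuous_on[OF g] lim x ev
    by (rule continuous_on_tendsto_compose)
  then have "(\<lambda>k. ereal (g (?\<epsilon> k *\<^sub>R u k))) \<longlonglongrightarrow> ereal (g x)"
    by simp
  moreover have "\<forall>\<^sub>F k in sequentially. ereal (g (?\<epsilon> k *\<^sub>R u k)) \<le> ereal (?\<epsilon> k * f (u k))"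
    using ev
  proof eventually_elim
    case (elim k)
    have "u k \<in> open_cone S"
      using open_cone_scale[OF elim, of "real (Suc k)"] by (simp del: of_nat_Suc)
    then show ?case
      using g(1) le[of "u k"] uS by (simp add: homogeneous_on_def)
  qed
  ultimately show ?thesis
    using tendsto_le[OF trivial_limit_sequentially asymptotic_limit(2)[OF x u]] by blast
qed

text \<open>Split \<open>y\<close> as \<open>(y - d x) + d x\<close> inside the cone: the second
  part has value minus infinity and the first is not plus infinity, so subadditivity gives the value
  at \<open>y\<close>.\<close>

lemma asymptotic_minus_infinity:
  assumes x: "x \<in> open_cone S" "asymptotic S f x = - \<infinity>" and y: "y \<in> open_cone S"
  shows "asymptotic S f y = - \<infinity>"
proof -
  obtain d where d: "0 < d" "y - d *\<^sub>R x \<in> open_cone S"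
    using open_cone_shift[OF y] subsetD[OF open_cone_subset_span x(1)] by blast
  have "asymptotic S f (d *\<^sub>R x) = - \<infinity>"
    using asymptotic_scale[OF x(1) d(1)] x(2) d(1) by simp
  moreover have "asymptotic S f (y - d *\<^sub>R x) \<noteq> \<infinity>"
    by (rule asymptotic_limit(1)[OF d(2)])
  ultimately show ?thesis
    using asymptotic_add[OF d(2) open_cone_scale[OF x(1) d(1)]]
    by (cases "asymptotic S f (y - d *\<^sub>R x)") auto
qed

end

section \<open>Assembly of the limit statement and the dichotomy\<close>

theorem theorem6p2:
  fixes S :: "'a::euclidean_space set" and f :: "'a \<Rightarrow> real"
  assumes "discrete_semigroup S"
    and "subadditive_on S f"
  shows
    "(\<forall>x\<in>open_cone S.
        (\<exists>\<epsilon> u. approx_seq S x \<epsilon> u) \<and>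
        asymptotic S f x \<noteq> \<infinity> \<and>
        (\<forall>\<epsilon> u. approx_seq S x \<epsilon> u \<longrightarrow>
           (\<lambda>k. ereal (\<epsilon> k * f (u k))) \<longlonglongrightarrow> asymptotic S f x)) \<and>
     ((\<forall>x\<in>open_cone S. asymptotic S f x = - \<infinity>) \<or>
      (\<exists>h :: 'a \<Rightarrow> real.
        (\<forall>x\<in>open_cone S. asymptotic S f x = ereal (h x)) \<and>
        homogeneous_on (open_cone S) h \<and>
        subadditive_on (open_cone S) h \<and>
        convex_on (open_cone S) h \<and>
        continuous_on (open_cone S) h \<and>
        (\<forall>u\<in>S \<inter> open_cone S. h u \<le> f u) \<and>
        (\<forall>g :: 'a \<Rightarrow> real.
           homogeneous_on (open_cone S) g \<and>
           subadditive_on (open_cone S) g \<and>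
           (\<forall>u\<in>S \<inter> open_cone S. g u \<le> f u) \<longrightarrow>
           (\<forall>x\<in>open_cone S. g x \<le> h x))))"
proof (intro conjI ballI)
  note S = assms
  let ?K = "open_cone S"
  fix x assume x: "x \<in> ?K"
  show "\<exists>\<epsilon> u. approx_seq S x \<epsilon> u"
    using approx_seq_exists[OF S x] by blast
  show "asymptotic S f x \<noteq> \<infinity>"
    by (rule asymptotic_limit(1)[OF S x])
  show "\<forall>\<epsilon> u. approx_seq S x \<epsilon> u \<longrightarrow> (\<lambda>k. ereal (\<epsilon> k * f (u k))) \<longlonglongrightarrow> asymptotic S f x"
    using asymptotic_limit(2)[OF S x] by blast
next
  note S = assms
  let ?K = "open_cone S"
  show "(\<forall>x\<in>?K. asymptotic S f x = - \<infinity>) \<or>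
    (\<exists>h. (\<forall>x\<in>?K. asymptotic S f x = ereal (h x)) \<and> homogeneous_on ?K h \<and> subadditive_on ?K h \<and>
      convex_on ?K h \<and> continuous_on ?K h \<and> (\<forall>u\<in>S \<inter> ?K. h u \<le> f u) \<and>
      (\<forall>g. homogeneous_on ?K g \<and> subadditive_on ?K g \<and> (\<forall>u\<in>S \<inter> ?K. g u \<le> f u) \<longrightarrow>
        (\<forall>x\<in>?K. g x \<le> h x)))"
  proof (cases "\<exists>x\<in>?K. asymptotic S f x = - \<infinity>")
    case True
    then show ?thesis
      using asymptotic_minus_infinity[OF S] by blast
  next
    case False
    \<comment> \<open>In this case both infinite values are excluded on the cone, so
      \<open>real_of_ereal\<close> loses no information there.\<close>
    define h where "h x = real_of_ereal (asymptotic S f x)" for x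
    have h: "asymptotic S f x = ereal (h x)" if "x \<in> ?K" for x
      using False asymptotic_limit(1)[OF S that] that unfolding h_def
      by (cases "asymptotic S f x") auto
    have hom: "homogeneous_on ?K h"
      unfolding homogeneous_on_def
    proof (intro ballI allI impI)
      fix x and t :: real
      assume "x \<in> ?K" "0 < t"
      then show "h (t *\<^sub>R x) = t * h x"
        using asymptotic_scale[OF S, of x t] by (simp add: h open_cone_scale)
    qed
    have sub: "subadditive_on ?K h"
      unfolding subadditive_on_def
    proof (intro ballI)
      fix x y
      assume "x \<in> ?K" "y \<in> ?K"
      then show "h (x + y) \<le> h x + h y"
        using asymptotic_add[OF S, of x y] by (simp add: h open_cone_add)
    qed
    have le: "h u \<le> f u" if "u \<in> S \<inter> ?K" for u
      using asymptotic_le[OF S, of u] that by (simp add: h)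
    have greatest: "g x \<le> h x"
      if "homogeneous_on ?K g" "subadditive_on ?K g" "\<forall>u\<in>S \<inter> ?K. g u \<le> f u" "x \<in> ?K" for g x
      using asymptotic_greatest[OF S that(1,2) _ that(4)] that(3,4) by (simp add: h)
    show ?thesis
      using h hom sub homogeneous_subadditive_imp_convex_on[OF hom sub]
        homogeneous_subadditive_imp_continuous_on[OF hom sub] le greatest
      by (intro disjI2 exI[of _ h]) blast
  qed
qed

end
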